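(* Let $S$ be a right LCM semigroup with identity. If $S$ is (3) a group, or (4) abelian, or (5) isomorphic to the free monoid $\mathbb{F}_n^+$ on $n$ generators for some $1\leq n<\infty$, or (6) given by the Zappa-Szép product $X^*\bowtie G$ for a self-similar action $(G,X)$, then either (1) $S$ is directed with respect to $\leq$, or (2) incomparable elements of $S$ have disjoint principal right ideals. In particular, $S$ has property (AR).
   Context: All semigroups are countable, discrete and left cancellative. A semigroup is right LCM if the intersection of two principal right ideals is either empty or again a principal right ideal. For $s,t\in S$ write $s\leq t$ if $t\in sS$. Elements $s,t$ are comparable if $s\leq t$ or $t\leq s$, and incomparable otherwise. $S$ is directed with respect to $\leq$ if $sS\cap tS\neq\emptyset$ for all $s,t\in S$. A finite subset $F\subset S$ is a foundation set for $S$ if for every $s\in S$ there is $t\in F$ with $sS\cap tS\neq\emptyset$. A foundation set $F$ is accurate if $sS\cap tS=\emptyset$ for all distinct $s,t\in F$. $S$ has the accurate refinement property, property (AR), if for every foundation set $F$ there is an accurate foundation set $F_a$ such that every $f_a\in F_a$ lies in $fS$ for some $f\in F$. A self-similar action $(G,X)$ consists of a group $G$, a finite alphabet $X$ and a faithful action of $G$ on the set $X^*$ of finite words (the free monoid on $X$) such that for all $g\in G$, $x\in X$ there is a unique $g|_x\in G$ with $g\cdot(xw)=(g\cdot x)(g|_x\cdot w)$ for all $w\in X^*$ (with $g\cdot x\in X$); restrictions extend to words by $g|_{vw}=(g|_v)|_w$ and $g|_{\varnothing}=g$. The monoid $X^*\bowtie G$ is the set $X^*\times G$ with product $(v,g)(w,h)=(v(g\cdot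 w),\,g|_w h)$. *)

theory Defs
  imports "HOL-Algebra.Group_Action" "HOL-Library.Countable_Set"
begin

section \<open>Right LCM semigroups with identity\<close>

text \<open>
  The principal right ideal of \<open>s\<close> in \<open>S\<close> is the library coset \<open>s <#\<^bsub>S\<^esub> carrier S\<close>.
  Countability and left cancellation are standing assumptions on all semigroups; discreteness
  carries no content, since no topology is involved.
\<close>

locale right_LCM_monoid = monoid S for S (structure) +
  assumes countable_carrier: "countable (carrier S)"
    and left_cancel:
      "\<lbrakk>a \<in> carrier S; b \<in> carrier S; c \<in> carrier S; a \<otimes> b = a \<otimes> c\<rbrakk> \<Longrightarrow> b = c"
    and right_LCM:
      "\<lbrakk>s \<in> carrier S; t \<in> carrier S\<rbrakk> \<Longrightarrow>
        (s <# carrier S) \<inter> (t <# carrier S) = {} \<or>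
        (\<exists>r\<in>carrier S. (s <# carrier S) \<inter> (t <# carrier S) = r <# carrier S)"

definition ideal_le :: "('a, 'b) monoid_scheme \<Rightarrow> 'a \<Rightarrow> 'a \<Rightarrow> bool"
  where "ideal_le S s t \<longleftrightarrow> t \<in> s <#\<^bsub>S\<^esub> carrier S"

definition incomparable :: "('a, 'b) monoid_scheme \<Rightarrow> 'a \<Rightarrow> 'a \<Rightarrow> bool"
  where "incomparable S s t \<longleftrightarrow> \<not> (ideal_le S s t \<or> ideal_le S t s)"

definition directed_monoid :: "('a, 'b) monoid_scheme \<Rightarrow> bool"
  where "directed_monoid S \<longleftrightarrow>
    (\<forall>s\<in>carrier S. \<forall>t\<in>carrier S. (s <#\<^bsub>S\<^esub> carrier S) \<inter> (t <#\<^bsub>S\<^esub> carrier S) \<noteq> {})"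

definition incomparable_disjoint :: "('a, 'b) monoid_scheme \<Rightarrow> bool"
  where "incomparable_disjoint S \<longleftrightarrow>
    (\<forall>s\<in>carrier S. \<forall>t\<in>carrier S. incomparable S s t \<longrightarrow>
      (s <#\<^bsub>S\<^esub> carrier S) \<inter> (t <#\<^bsub>S\<^esub> carrier S) = {})"

definition foundation_set :: "('a, 'b) monoid_scheme \<Rightarrow> 'a set \<Rightarrow> bool"
  where "foundation_set S F \<longleftrightarrow> finite F \<and> F \<subseteq> carrier S \<and>
    (\<forall>s\<in>carrier S. \<exists>t\<in>F. (s <#\<^bsub>S\<^esub> carrier S) \<inter> (t <#\<^bsub>S\<^esub> carrier S) \<noteq> {})"

definition accurate_foundation_set :: "('a, 'b) monoid_scheme \<Rightarrow> 'a set \<Rightarrow> bool"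
  where "accurate_foundation_set S F \<longleftrightarrow> foundation_set S F \<and>
    (\<forall>s\<in>F. \<forall>t\<in>F. s \<noteq> t \<longrightarrow> (s <#\<^bsub>S\<^esub> carrier S) \<inter> (t <#\<^bsub>S\<^esub> carrier S) = {})"

definition property_AR :: "('a, 'b) monoid_scheme \<Rightarrow> bool"
  where "property_AR S \<longleftrightarrow>
    (\<forall>F. foundation_set S F \<longrightarrow>
      (\<exists>Fa. accurate_foundation_set S Fa \<and> (\<forall>fa\<in>Fa. \<exists>f\<in>F. fa \<in> f <#\<^bsub>S\<^esub> carrier S)))"


section \<open>Free monoids and Zappa-Szep products\<close>

definition free_monoid :: "'x set \<Rightarrow> 'x list monoid"
  where "free_monoid X = \<lparr>carrier = lists X, mult = (@), one = []\<rparr>"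

text \<open>
  The word \<open>xw\<close> is \<open>x # w\<close>, the letter \<open>x\<close> is the one-letter word \<open>[x]\<close>, and the action is
  given by its permutation representation \<open>\<phi>\<close> on \<open>lists X\<close>.
\<close>

definition is_restriction ::
    "('g, 'b) monoid_scheme \<Rightarrow> 'x set \<Rightarrow> ('g \<Rightarrow> 'x list \<Rightarrow> 'x list) \<Rightarrow> 'g \<Rightarrow> 'x \<Rightarrow> 'g \<Rightarrow> bool"
  where "is_restriction G X \<phi> g x h \<longleftrightarrow>
    h \<in> carrier G \<and> (\<forall>w\<in>lists X. \<phi> g (x # w) = \<phi> g [x] @ \<phi> h w)"

locale self_similar_action =
  faithful_action G "lists X" \<phi> for G (structure) and X :: "'x set" and \<phi> +
  assumes finite_alphabet: "finite X"
    and letter_image: "\<lbrakk>g \<in> carrier G; x \<in> X\<rbrakk> \<Longrightarrow> \<exists>y\<in>X. \<phi> g [x] = [y]"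
    and unique_restriction: "\<lbrakk>g \<in> carrier G; x \<in> X\<rbrakk> \<Longrightarrow> \<exists>!h. is_restriction G X \<phi> g x h"

definition restriction ::
    "('g, 'b) monoid_scheme \<Rightarrow> 'x set \<Rightarrow> ('g \<Rightarrow> 'x list \<Rightarrow> 'x list) \<Rightarrow> 'g \<Rightarrow> 'x \<Rightarrow> 'g"
  where "restriction G X \<phi> g x = (THE h. is_restriction G X \<phi> g x h)"

primrec word_restriction ::
    "('g, 'b) monoid_scheme \<Rightarrow> 'x set \<Rightarrow> ('g \<Rightarrow> 'x list \<Rightarrow> 'x list) \<Rightarrow> 'g \<Rightarrow> 'x list \<Rightarrow> 'g"
  where
    "word_restriction G X \<phi> g [] = g"
  | "word_restriction G X \<phi> g (x # w) = word_restriction G X \<phi> (restriction G X \<phi> g x) w"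

definition zappa_szep ::
    "('g, 'b) monoid_scheme \<Rightarrow> 'x set \<Rightarrow> ('g \<Rightarrow> 'x list \<Rightarrow> 'x list) \<Rightarrow> ('x list \<times> 'g) monoid"
  where "zappa_szep G X \<phi> =
    \<lparr>carrier = lists X \<times> carrier G,
     mult = (\<lambda>(v, g) (w, h). (v @ \<phi> g w, word_restriction G X \<phi> g w \<otimes>\<^bsub>G\<^esub> h)),
     one = ([], \<one>\<^bsub>G\<^esub>)\<rparr>"

end

theory Submission
  imports Defs
begin

text \<open>
  In the free monoid, and in \<open>X\<^sup>* \<bowtie> G\<close>, the principal right ideal of an element is
  determined by its word: since each \<open>g\<close> permutes the words and restrictions lie in the group
  \<open>G\<close>, the ideal of \<open>(v, g)\<close> is \<open>vX\<^sup>* \<times> G\<close>. Two words with a common extension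
  are comparable for the prefix order, which gives alternative (2). Groups and abelian monoids
  are directed. Property (AR) holds because a directed monoid has singleton foundation sets inside
  every foundation set, while under (2) a foundation set contained in the given one and of least
  cardinality is accurate: of two comparable elements, the larger one is redundant.
\<close>

lemma mem_l_coset_iff: "x \<in> s <#\<^bsub>S\<^esub> A \<longleftrightarrow> (\<exists>a\<in>A. x = s \<otimes>\<^bsub>S\<^esub> a)"
  by (auto simp: l_coset_def)

lemma (in monoid) l_coset_mono:
  assumes "s \<in> carrier G" "t \<in> s <# carrier G"
  shows "t <# carrier G \<subseteq> s <# carrier G"
proof
  fix x assume "x \<in> t <# carrier G"
  with assms obtain a b where "a \<in> carrier G" "b \<in> carrier G" "x = s \<otimes> (a \<otimes> b)"
    by (auto simp: mem_l_coset_iff m_assoc)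
  then show "x \<in> s <# carrier G"
    unfolding mem_l_coset_iff by blast
qed

lemma (in monoid) mem_l_coset_self:
  assumes "s \<in> carrier G"
  shows "s \<in> s <# carrier G"
  unfolding mem_l_coset_iff using assms by (intro bexI[of _ \<one>]) auto

lemma (in monoid) directed_imp_AR:
  assumes "directed_monoid G"
  shows "property_AR G"
  unfolding property_AR_def
proof (intro allI impI)
  fix F assume F: "foundation_set G F"
  \<comment> \<open>A foundation set is nonempty, since some member's ideal must meet the ideal of
    \<one>.\<close>
  then obtain f where f: "f \<in> F"
    unfolding foundation_set_def using one_closed by blast
  with F have fc: "f \<in> carrier G" by (auto simp: foundation_set_def)
  have "accurate_foundation_set G {f}"
    using assms fc by (auto simp: accurate_foundation_set_def foundation_set_def directed_monoid_def)
  with f mem_l_coset_self[OF fc]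
  show "\<exists>Fa. accurate_foundation_set G Fa \<and> (\<forall>fa\<in>Fa. \<exists>f\<in>F. fa \<in> f <# carrier G)"
    by blast
qed

text \<open>The ideal of \<open>t\<close> lies inside that of \<open>s\<close>, so any ideal that
  meets the former also meets the latter, and \<open>s\<close> takes over the role of
  \<open>t\<close>.\<close>

lemma (in monoid) foundation_set_remove:
  assumes F: "foundation_set G F" and s: "s \<in> F" and "s \<noteq> t"
    and t: "t \<in> s <# carrier G"
  shows "foundation_set G (F - {t})"
  unfolding foundation_set_def
proof (intro conjI ballI)
  show "finite (F - {t})" "F - {t} \<subseteq> carrier G"
    using F by (auto simp: foundation_set_def)
  fix u assume "u \<in> carrier G"
  then obtain r where r: "r \<in> F" "(u <# carrier G) \<inter> (r <# carrier G) \<noteq> {}"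
 using F unfolding foundation_set_def by blast
  have "s \<in> carrier G" using F s by (auto simp: foundation_set_def)
  then have mono: "t <# carrier G \<subseteq> s <# carrier G" using t by (rule l_coset_mono)
  show "\<exists>r\<in>F - {t}. (u <# carrier G) \<inter> (r <# carrier G) \<noteq> {}"
  proof (cases "r = t")
    case True
    with r mono have "(u <# carrier G) \<inter> (s <# carrier G) \<noteq> {}" by blast
    with s \<open>s \<noteq> t\<close> show ?thesis by (intro bexI[of _ s]) auto
  next
    case False
    with r show ?thesis by (intro bexI[of _ r]) auto
  qed
qed

lemma (in monoid) incomparable_disjoint_imp_AR:
  assumes "incomparable_disjoint G"
  shows "property_AR G"
  unfolding property_AR_def
proof (intro allI impI)
  fix F assume F: "foundation_set G F"
  obtain Fa where Fa: "foundation_set G Fa" "Fa \<subseteq> F"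
    and least: "\<And>H. foundation_set G H \<Longrightarrow> H \<subseteq> F \<Longrightarrow> card Fa \<le> card H"
    \<comment> \<open>\<open>F\<close> itself is a candidate, so a candidate of least cardinality
      exists.\<close>
    using ex_has_least_nat[of "\<lambda>H. foundation_set G H \<and> H \<subseteq> F" F card] F by blast
  have sub: "Fa \<subseteq> carrier G" and fin: "finite Fa"
    using Fa by (auto simp: foundation_set_def)
  have irredundant: "t \<notin> s <# carrier G" if "s \<in> Fa" "t \<in> Fa" "s \<noteq> t" for s t
  proof
    assume "t \<in> s <# carrier G"
    with Fa that have "foundation_set G (Fa - {t})" by (intro foundation_set_remove)
    then have "card Fa \<le> card (Fa - {t})" using Fa(2) by (intro least) auto
    moreover have "card (Fa - {t}) < card Fa"
      using fin \<open>t \<in> Fa\<close> by (rule card_Diff1_less)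
    ultimately show False by simp
  qed
  have "(s <# carrier G) \<inter> (t <# carrier G) = {}" if "s \<in> Fa" "t \<in> Fa" "s \<noteq> t" for s t
  proof -
    have "incomparable G s t"
      using irredundant[of s t] irredundant[of t s] that by (auto simp: incomparable_def ideal_le_def)
    then show ?thesis
      using assms sub that by (auto simp only: incomparable_disjoint_def subset_iff)
  qed
  with Fa(1) have "accurate_foundation_set G Fa"
    by (simp add: accurate_foundation_set_def)
  then show "\<exists>Fa. accurate_foundation_set G Fa \<and> (\<forall>fa\<in>Fa. \<exists>f\<in>F. fa \<in> f <# carrier G)"
    \<comment> \<open>Refinement is immediate: each member of \<open>Fa\<close> is already in
      \<open>F\<close> and lies in its own ideal.\<close>
    using Fa(2) sub mem_l_coset_self by blast
qed

text \<open>The equation \<open>s \<otimes> x = t\<close> is always solvable, so every principal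
  right ideal is the whole group.\<close>

lemma (in group) directed_group: "directed_monoid G"
proof -
  have "t \<in> s <# carrier G" if "s \<in> carrier G" "t \<in> carrier G" for s t
    unfolding mem_l_coset_iff using that
    by (intro bexI[of _ "inv s \<otimes> t"]) (simp_all add: m_assoc[symmetric])
  then show ?thesis
    unfolding directed_monoid_def using mem_l_coset_self by blast
qed

lemma (in comm_monoid) directed_comm_monoid: "directed_monoid G"
  unfolding directed_monoid_def
proof (intro ballI)
  fix s t assume st: "s \<in> carrier G" "t \<in> carrier G"
  then have "s \<otimes> t \<in> s <# carrier G" "t \<otimes> s \<in> t <# carrier G"
    by (auto simp: l_coset_def)
  then have "s \<otimes> t \<in> s <# carrier G" "s \<otimes> t \<in> t <# carrier G"
    using m_comm[OF st] by simp_all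
  then show "(s <# carrier G) \<inter> (t <# carrier G) \<noteq> {}" by blast
qed

text \<open>Surjectivity of \<open>h\<close> pulls the right factor back from \<open>T\<close> to
  \<open>S\<close>; injectivity then cancels \<open>h\<close>.\<close>

lemma iso_mem_l_coset_iff:
  assumes h: "h \<in> iso S T" and "monoid S" and s: "s \<in> carrier S" and t: "t \<in> carrier S"
  shows "h t \<in> h s <#\<^bsub>T\<^esub> carrier T \<longleftrightarrow> t \<in> s <#\<^bsub>S\<^esub> carrier S"
proof -
  have hom: "h (s \<otimes>\<^bsub>S\<^esub> u) = h s \<otimes>\<^bsub>T\<^esub> h u" if "u \<in> carrier S" for u
    using h s that by (auto simp: iso_def hom_def)
  have im: "h ` carrier S = carrier T" and inj: "inj_on h (carrier S)"
    using h by (auto simp: iso_def bij_betw_def)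
  have "h t \<in> h s <#\<^bsub>T\<^esub> carrier T \<longleftrightarrow> (\<exists>u\<in>carrier S. h t = h (s \<otimes>\<^bsub>S\<^esub> u))"
    unfolding mem_l_coset_iff im[symmetric] by (simp add: hom)
  also have "\<dots> \<longleftrightarrow> t \<in> s <#\<^bsub>S\<^esub> carrier S"
    unfolding mem_l_coset_iff
    using inj t s monoid.m_closed[OF \<open>monoid S\<close> s] by (auto dest: inj_onD)
  finally show ?thesis .
qed

lemma iso_incomparable_disjoint:
  assumes "S \<cong> T" "monoid S" "incomparable_disjoint T"
  shows "incomparable_disjoint S"
  unfolding incomparable_disjoint_def
proof (intro ballI impI)
  fix s t assume s: "s \<in> carrier S" and t: "t \<in> carrier S" and inc: "incomparable S s t"
  obtain h where h: "h \<in> iso S T" using assms(1) by (auto simp: is_iso_def)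
  note mem_iff = iso_mem_l_coset_iff[OF h \<open>monoid S\<close>]
  have hc: "h s \<in> carrier T" "h t \<in> carrier T"
    using h s t by (auto simp: iso_def bij_betw_def)
  have "incomparable T (h s) (h t)"
    using inc s t by (simp add: incomparable_def ideal_le_def mem_iff)
  then have disj: "(h s <#\<^bsub>T\<^esub> carrier T) \<inter> (h t <#\<^bsub>T\<^esub> carrier T) = {}"
    using assms(3) hc by (auto simp: incomparable_disjoint_def)
  \<comment> \<open>A common element of the two ideals in \<open>S\<close> would be carried to a
    common element of their counterparts in \<open>T\<close>.\<close>
  have "h x \<in> (h s <#\<^bsub>T\<^esub> carrier T) \<inter> (h t <#\<^bsub>T\<^esub> carrier T)"
    if x: "x \<in> s <#\<^bsub>S\<^esub> carrier S" "x \<in> t <#\<^bsub>S\<^esub> carrier S" for x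
  proof -
    have "x \<in> carrier S"
      using x(1) monoid.m_closed[OF \<open>monoid S\<close> s] by (auto simp: mem_l_coset_iff)
    with x s t show ?thesis by (simp add: mem_iff)
  qed
  with disj show "(s <#\<^bsub>S\<^esub> carrier S) \<inter> (t <#\<^bsub>S\<^esub> carrier S) = {}" by blast
qed

text \<open>Shared core of the free monoid and the Zappa-Szep product: \<open>word\<close> reduces
  the ideal order to the prefix order, where two prefixes of one word are comparable.\<close>

lemma incomparable_disjoint_of_word:
  fixes word :: "'a \<Rightarrow> 'x list"
  assumes word: "\<And>s. s \<in> carrier T \<Longrightarrow> word s \<in> lists X"
    and ideal: "\<And>s t. s \<in> carrier T \<Longrightarrow>
      t \<in> s <#\<^bsub>T\<^esub> carrier T \<longleftrightarrow> t \<in> carrier T \<and> (\<exists>u\<in>lists X. word t = word s @ u)"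
  shows "incomparable_disjoint T"
  unfolding incomparable_disjoint_def
proof (intro ballI impI, rule ccontr)
  fix s t assume s: "s \<in> carrier T" and t: "t \<in> carrier T" and inc: "incomparable T s t"
    and "(s <#\<^bsub>T\<^esub> carrier T) \<inter> (t <#\<^bsub>T\<^esub> carrier T) \<noteq> {}"
  then obtain u v where "word s @ u = word t @ v"
    using ideal[OF s] ideal[OF t] by fastforce
  \<comment> \<open>Levi's lemma: of two factorisations of one word, the longer first factor extends
    the shorter by some \<open>w\<close>.\<close>
  then obtain w where w: "word t = word s @ w \<or> word s = word t @ w"
    by (auto simp: append_eq_append_conv2 dest: sym)
  \<comment> \<open>\<open>w\<close> is a suffix of a word over \<open>X\<close>, as the criterion
    \<open>ideal\<close> demands.\<close>
  then have "w \<in> lists X"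
    using word[OF s] word[OF t] by auto
  with w have "t \<in> s <#\<^bsub>T\<^esub> carrier T \<or> s \<in> t <#\<^bsub>T\<^esub> carrier T"
    unfolding ideal[OF s] ideal[OF t] using s t by blast
  with inc show False by (simp add: incomparable_def ideal_le_def)
qed

lemma incomparable_disjoint_free_monoid: "incomparable_disjoint (free_monoid X)"
  by (rule incomparable_disjoint_of_word[where word = "\<lambda>w. w" and X = X])
    (auto simp: mem_l_coset_iff free_monoid_def)

context self_similar_action
begin

lemma restriction_closed:
  assumes "g \<in> carrier G" "x \<in> X"
  shows "restriction G X \<phi> g x \<in> carrier G"
  using theI'[OF unique_restriction[OF assms]]
  unfolding restriction_def is_restriction_def by (rule conjunct1)

lemma word_restriction_closed:
  assumes "g \<in> carrier G" "w \<in> lists X"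
  shows "word_restriction G X \<phi> g w \<in> carrier G"
  \<comment> \<open>\<open>g\<close> must vary, because the recursion replaces it by its restriction
    to the first letter.\<close>
  using assms(2,1) by (induction w arbitrary: g) (auto simp: restriction_closed)

lemma mem_l_coset_zappa_szep_iff:
  assumes g: "g \<in> carrier G"
  shows "(y, k) \<in> (v, g) <#\<^bsub>zappa_szep G X \<phi>\<^esub> carrier (zappa_szep G X \<phi>) \<longleftrightarrow>
    (\<exists>u\<in>lists X. y = v @ u) \<and> k \<in> carrier G" (is "?L \<longleftrightarrow> ?R")
proof -
  have "group G" using group_hom by (simp add: group_hom_def)
  then interpret group G .
  have perm: "\<phi> g ` lists X = lists X" using g by (rule surj_prop)
  have "?L \<longleftrightarrow> (\<exists>w\<in>lists X. y = v @ \<phi> g w \<and>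
      (\<exists>h\<in>carrier G. k = word_restriction G X \<phi> g w \<otimes> h))"
    by (auto simp: mem_l_coset_iff zappa_szep_def)
  \<comment> \<open>For fixed \<open>w\<close>, left multiplication by the restriction is onto the
    group, so the second coordinate is arbitrary; the factor \<open>h\<close> is found by inverting
    the restriction.\<close>
  also have "\<dots> \<longleftrightarrow> (\<exists>w\<in>lists X. y = v @ \<phi> g w \<and> k \<in> carrier G)"
  proof (intro bex_cong refl conj_cong)
    fix w assume "w \<in> lists X"
    then have r: "word_restriction G X \<phi> g w \<in> carrier G" (is "?r \<in> _")
      using g by (intro word_restriction_closed)
    have "k = ?r \<otimes> (inv ?r \<otimes> k)" if "k \<in> carrier G"
      using r that by (metis inv_closed m_assoc r_inv l_one)
    then show "(\<exists>h\<in>carrier G. k = ?r \<otimes> h) \<longleftrightarrow> k \<in> carrier G"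
      using r by blast
  qed
  \<comment> \<open>Substituting \<open>u\<close> for \<open>\<phi> g w\<close> leaves an image that
    is all of \<open>lists X\<close>, because \<open>g\<close> permutes the words.\<close>
  also have "\<dots> \<longleftrightarrow> (\<exists>u\<in>\<phi> g ` lists X. y = v @ u) \<and> k \<in> carrier G"
    by blast
  finally show ?thesis unfolding perm .
qed

text \<open>Only the word component decides comparability; the group component can always be
  adjusted.\<close>

lemma incomparable_disjoint_zappa_szep: "incomparable_disjoint (zappa_szep G X \<phi>)"
proof (rule incomparable_disjoint_of_word[where word = fst and X = X])
  fix s t assume s: "s \<in> carrier (zappa_szep G X \<phi>)"
  then have v: "fst s \<in> lists X" and g: "snd s \<in> carrier G"
    by (auto simp: zappa_szep_def)
  have "t \<in> carrier (zappa_szep G X \<phi>) \<longleftrightarrow> fst t \<in> lists X \<and> snd t \<in> carrier G"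
    by (auto simp: zappa_szep_def mem_Times_iff)
  with v mem_l_coset_zappa_szep_iff[OF g, of "fst t" "snd t" "fst s"]
  show "t \<in> s <#\<^bsub>zappa_szep G X \<phi>\<^esub> carrier (zappa_szep G X \<phi>) \<longleftrightarrow>
      t \<in> carrier (zappa_szep G X \<phi>) \<and> (\<exists>u\<in>lists X. fst t = fst s @ u)"
    by auto
qed (auto simp: zappa_szep_def)

end

theorem corollary2p7:
  fixes S :: "('a, 'b) monoid_scheme"
  assumes "right_LCM_monoid S"
    and "group S
      \<or> comm_monoid S
      \<or> (\<exists>n::nat. 1 \<le> n \<and> S \<cong> free_monoid {..<n})
      \<or> (\<exists>(G :: 'g monoid) (X :: 'x set) \<phi>. self_similar_action G X \<phi> \<and> S \<cong> zappa_szep G X \<phi>)"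
  shows "(directed_monoid S \<or> incomparable_disjoint S) \<and> property_AR S"
proof -
  interpret right_LCM_monoid S by fact
  \<comment> \<open>The free monoid and the Zappa-Szep product are given only up to isomorphism, so
    disjointness is carried back to \<open>S\<close>.\<close>
  note transfer = iso_incomparable_disjoint[OF _ monoid_axioms]
  have "directed_monoid S \<or> incomparable_disjoint S"
    using assms(2)
  proof (elim disjE exE conjE)
    assume "group S"
    then show ?thesis by (simp add: group.directed_group)
  next
    assume "comm_monoid S"
    then show ?thesis by (simp add: comm_monoid.directed_comm_monoid)
  next
    fix n :: nat assume "S \<cong> free_monoid {..<n}"
    then show ?thesis using transfer incomparable_disjoint_free_monoid by blast
  next
    fix G :: "'g monoid" and X :: "'x set" and \<phi>
    assume "self_similar_action G X \<phi>" "S \<cong> zappa_szep G X \<phi>"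
    then show ?thesis
      using transfer self_similar_action.incomparable_disjoint_zappa_szep by blast
  qed
  then show ?thesis using directed_imp_AR incomparable_disjoint_imp_AR by blast
qed

end
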